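(* Let $n\geq 1$ and $0\leq k\leq n-1$ be integers, and let $Q_n^{(k)}(x)$ be the $k$th derivative of $Q_n(x)$. If $n+k+1$ is prime, or if $2n+1$ is prime, then $Q_n^{(k)}(x)$ is irreducible over $\mathbb{Q}$.
   Context: For each integer $n\geq 0$, $P_n(x),Q_n(x)\in\mathbb{Q}[x]$ denote the unique pair of polynomials with $\deg P_n\leq n$, $\deg Q_n\leq n$ satisfying $P_n(x)x^{n+1}+Q_n(x)(x+1)^{n+1}=1$. *)

theory Defs
  imports
    "HOL-Computational_Algebra.Computational_Algebra"
    "HOL-Computational_Algebra.Field_as_Ring"
begin

definition bezout_pair :: "nat \<Rightarrow> rat poly \<Rightarrow> rat poly \<Rightarrow> bool" where
  "bezout_pair n P Q \<longleftrightarrow>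
     degree P \<le> n \<and> degree Q \<le> n \<and>
     P * [:0, 1:] ^ (n + 1) + Q * [:1, 1:] ^ (n + 1) = 1"

definition PQ_poly :: "nat \<Rightarrow> rat poly \<times> rat poly" where
  "PQ_poly n = (THE (P, Q). bezout_pair n P Q)"

definition P_poly :: "nat \<Rightarrow> rat poly" where
  "P_poly n = fst (PQ_poly n)"

definition Q_poly :: "nat \<Rightarrow> rat poly" where
  "Q_poly n = snd (PQ_poly n)"

lemma coprime_powers_x_x1:
  "coprime ([:0, 1:] ^ m :: rat poly) ([:1, 1:] ^ m)"
proof -
  have "coprime [:0, 1::rat:] [:1, 1:]"
  proof (rule coprimeI)
    fix c :: "rat poly"
    assume "c dvd [:0, 1:]" "c dvd [:1, 1:]"
    hence "c dvd [:1, 1:] - [:0, 1:]" by (rule dvd_diff[rotated])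
    thus "is_unit c" by (simp add: one_pCons)
  qed
  thus ?thesis unfolding coprime_power_left_iff coprime_power_right_iff by blast
qed

lemma bezout_pair_exists: "\<exists>P Q. bezout_pair n P Q"
proof -
  define a b :: "rat poly" where "a = [:0, 1:] ^ (n + 1)" and "b = [:1, 1:] ^ (n + 1)"
  have da: "degree a = n + 1" and db: "degree b = n + 1"
    unfolding a_def b_def by (rule degree_linear_power)+
  have b0: "b \<noteq> 0" using db by auto
  have cop: "coprime a b" unfolding a_def b_def by (rule coprime_powers_x_x1)
  obtain u v where uv: "u * a + v * b = 1"
    using bezout_coefficients_fst_snd[of a b] unfolding coprime_imp_gcd_eq_1[OF cop] by blast
  define P where "P = u mod b"
  define Q where "Q = v + (u div b) * a"
  have eq: "P * a + Q * b = 1"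
  proof -
    have "P * a + Q * b = (u div b * b + u mod b) * a + v * b"
      unfolding P_def Q_def by (simp only: algebra_simps)
    also have "\<dots> = 1" using uv by (simp only: div_mult_mod_eq)
    finally show ?thesis .
  qed
  have dP: "degree P \<le> n"
    using degree_mod_less[of b u] b0 db unfolding P_def by auto
  have dQ: "degree Q \<le> n"
  proof (cases "Q = 0")
    case False
    have "Q * b = 1 - P * a" using eq by (simp add: eq_diff_eq add.commute)
    moreover have "degree (1 - P * a) \<le> n + (n + 1)"
      using dP da degree_mult_le[of P a] by (intro degree_diff_le) auto
    ultimately have "degree Q + (n + 1) \<le> n + (n + 1)"
      using degree_mult_eq[OF False b0] db by simp
    thus ?thesis by simp
  qed simp
  from dP dQ eq show ?thesis unfolding bezout_pair_def a_def b_def by blast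
qed

lemma bezout_pair_unique:
  assumes "bezout_pair n P Q" "bezout_pair n P' Q'"
  shows "P = P' \<and> Q = Q'"
proof -
  define a b :: "rat poly" where "a = [:0, 1:] ^ (n + 1)" and "b = [:1, 1:] ^ (n + 1)"
  have db: "degree b = n + 1"
    unfolding b_def by (rule degree_linear_power)
  have b0: "b \<noteq> 0" using db by auto
  have cop: "coprime a b" unfolding a_def b_def by (rule coprime_powers_x_x1)
  have eq: "P * a + Q * b = 1" "P' * a + Q' * b = 1"
    using assms unfolding bezout_pair_def a_def b_def by blast+
  have "(P - P') * a - (Q' - Q) * b = (P * a + Q * b) - (P' * a + Q' * b)"
    by (simp add: algebra_simps)
  hence diff: "(P - P') * a = (Q' - Q) * b" using eq by simp
  hence "b dvd (P - P') * a" by simp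
  hence "b dvd P - P'"
    using cop by (simp add: coprime_commute coprime_dvd_mult_left_iff)
  moreover have "degree (P - P') \<le> n"
    using assms by (intro degree_diff_le) (simp_all only: bezout_pair_def)
  ultimately have "P - P' = 0"
    using db dvd_imp_degree_le[of b "P - P'"] by force
  with diff b0 show ?thesis by simp
qed

lemma bezout_pair_PQ: "bezout_pair n (P_poly n) (Q_poly n)"
proof -
  obtain P Q where PQ: "bezout_pair n P Q" using bezout_pair_exists by blast
  have "PQ_poly n = (P, Q)"
    unfolding PQ_poly_def
  proof (rule the_equality)
    show "case (P, Q) of (P, Q) \<Rightarrow> bezout_pair n P Q" using PQ by simp
  next
    fix p assume "case p of (P, Q) \<Rightarrow> bezout_pair n P Q"
    hence "bezout_pair n (fst p) (snd p)" by (simp add: split_def)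
    from bezout_pair_unique[OF PQ this] show "p = (P, Q)" by (simp add: prod_eq_iff)
  qed
  with PQ show ?thesis unfolding P_poly_def Q_poly_def by simp
qed

end

theory Submission
  imports Defs
begin

text \<open>
  Comparing power series, \<^term>\<open>Q_poly n\<close> is the truncation of \<open>(1 + x)^-(n+1)\<close> at degree \<open>n\<close>.
  Put \<open>N = n + k\<close> and \<open>m = n - k\<close>. Up to a nonzero constant, the \<open>k\<close>-th derivative at \<open>-x\<close> is
  then the polynomial \<open>F(x)\<close> whose coefficients are \<open>(N + i choose i)\<close> for \<open>i \<le> m\<close>.
  If \<open>p = N + 1\<close> is prime, all coefficients of \<open>F\<close> except the constant one are divisible by
  \<open>p\<close> exactly once, so the reversal of \<open>F\<close> is Eisenstein at \<open>p\<close>.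
  If \<open>p = N + m + 1 = 2n + 1\<close> is prime, then \<open>F(1 + y)\<close> has the coefficients
  \<open>(N + j choose j) (p choose N + j + 1)\<close>, so it is Eisenstein at \<open>p\<close>.
\<close>

section \<open>Eisenstein's criterion\<close>

lemma map_poly_of_int_mult:
  "map_poly (of_int :: int \<Rightarrow> 'a :: comm_ring_1) (p * q) = map_poly of_int p * map_poly of_int q"
  by (rule poly_eqI) (simp add: coeff_map_poly coeff_mult)

lemma map_poly_of_int_pcompose:
  "map_poly (of_int :: int \<Rightarrow> 'a :: comm_ring_1) (pcompose p q)
     = pcompose (map_poly of_int p) (map_poly of_int q)"
proof (induction p)
  case (pCons a p)
  have "map_poly of_int (pcompose (pCons a p) q)
          = [:of_int a:] + (map_poly of_int (q * pcompose p q) :: 'a poly)"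
    unfolding pcompose_pCons
    by (rule poly_eqI) (simp add: coeff_map_poly coeff_pCons split: nat.split)
  thus ?case
    by (simp add: map_poly_of_int_mult pCons.IH pcompose_pCons map_poly_pCons)
qed simp

lemma map_poly_rat_of_int_eq_iff:
  "map_poly rat_of_int p = map_poly rat_of_int q \<longleftrightarrow> p = q"
  by (auto simp: poly_eq_iff coeff_map_poly)

lemma rat_poly_clear_denominators:
  fixes g :: "rat poly"
  shows "\<exists>a G. a > 0 \<and> smult (rat_of_int a) g = map_poly of_int G"
proof (induction g)
  case 0
  show ?case by (rule exI[of _ 1], rule exI[of _ 0]) simp
next
  case (pCons c g)
  then obtain a G where a: "a > 0" and G: "smult (rat_of_int a) g = map_poly of_int G"
    by blast
  obtain x y where xy: "quotient_of c = (x, y)" by fastforce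
  have y: "y > 0" using quotient_of_denom_pos[OF xy] .
  have c: "c = of_int x / of_int y" using quotient_of_div[OF xy] .
  have "smult (rat_of_int (a * y)) (pCons c g)
          = pCons (of_int (a * x)) (smult (of_int y) (smult (of_int a) g))"
    using y by (simp add: c mult.commute)
  also have "\<dots> = map_poly of_int (pCons (a * x) (smult y G))"
    unfolding G by (rule poly_eqI) (simp add: coeff_map_poly coeff_pCons split: nat.split)
  finally show ?case using a y by (metis mult_pos_pos)
qed

text \<open>Gauss's lemma. After clearing denominators, \<open>smult (a * b) f = G * H\<close> over
  the integers. Primitive parts are multiplicative and ignore the positive constant
  \<open>a * b\<close>, so only the content of \<open>f\<close> has to be restored, and it goes to
  the first factor.\<close>

lemma int_poly_factor_of_rat_factor:
  fixes f :: "int poly"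
  assumes f: "f \<noteq> 0" and eq: "map_poly rat_of_int f = g * h"
  obtains G H where "f = G * H" "degree G = degree g" "degree H = degree h"
proof -
  obtain a G where a: "a > 0" and G: "smult (rat_of_int a) g = map_poly of_int G"
    using rat_poly_clear_denominators by blast
  obtain b H where b: "b > 0" and H: "smult (rat_of_int b) h = map_poly of_int H"
    using rat_poly_clear_denominators by blast
  have "map_poly rat_of_int (smult (a * b) f) = smult (of_int a) g * smult (of_int b) h"
    by (simp add: eq[symmetric] map_poly_smult mult.commute)
  hence GH: "smult (a * b) f = G * H"
    unfolding G H map_poly_of_int_mult[symmetric] map_poly_rat_of_int_eq_iff .
  have "smult (a * b) f \<noteq> 0" using a b f by simp
  hence nz: "G \<noteq> 0" "H \<noteq> 0" by (auto simp: GH)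
  have "primitive_part f = primitive_part (smult (a * b) f)"
    using a b by (simp add: primitive_part_smult)
  also have "\<dots> = primitive_part G * primitive_part H"
    unfolding GH by (rule primitive_part_mult)
  finally have "f = smult (content f) (primitive_part G) * primitive_part H"
    by (metis content_times_primitive_part mult_smult_left)
  moreover have "degree G = degree g" "degree H = degree h"
    using arg_cong[OF G, of degree] arg_cong[OF H, of degree] a b by (simp_all add: degree_map_poly)
  ultimately show ?thesis
    using f nz by (intro that[of "smult (content f) (primitive_part G)" "primitive_part H"]) auto
qed

text \<open>Let \<open>i\<close> be the first index where \<open>p\<close> does not divide
  \<open>coeff g i\<close>. Modulo \<open>p\<close> the coefficient of \<open>g * h\<close> at
  \<open>i\<close> is \<open>coeff g i * coeff h 0\<close>, which is nonzero. Only the leading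
  coefficient of the product may behave so, and \<open>i\<close> is at most \<open>degree g\<close>,
  which leaves no degree for \<open>h\<close>.\<close>

lemma eisenstein_no_split:
  fixes g h :: "int poly"
  assumes p: "prime p" and dvd: "\<And>i. i < degree (g * h) \<Longrightarrow> p dvd coeff (g * h) i"
    and lead: "\<not> p dvd lead_coeff (g * h)"
    and g0: "p dvd coeff g 0" and h0: "\<not> p dvd coeff h 0"
  shows "degree h = 0"
proof (rule ccontr)
  assume "degree h \<noteq> 0"
  have "\<not> p dvd lead_coeff g" using lead by (auto simp: lead_coeff_mult)
  define i where "i = (LEAST i. \<not> p dvd coeff g i)"
  have i: "\<not> p dvd coeff g i"
    unfolding i_def by (rule LeastI) fact
  have small: "p dvd coeff g j" if "j < i" for j
    using not_less_Least that unfolding i_def by blast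
  have "i \<le> degree g"
    unfolding i_def by (rule Least_le) fact
  moreover have "g * h \<noteq> 0" using lead by auto
  \<comment> \<open>Here the assumption that \<open>h\<close> is not constant enters: it puts
    \<open>i\<close> strictly below the leading index, within reach of \<open>dvd\<close>.\<close>
  ultimately have "i < degree (g * h)"
    using \<open>degree h \<noteq> 0\<close> by (subst degree_mult_eq) auto
  hence "p dvd coeff (g * h) i" by (rule dvd)
  also have "coeff (g * h) i = (\<Sum>j<i. coeff g j * coeff h (i - j)) + coeff g i * coeff h 0"
    by (simp add: coeff_mult flip: lessThan_Suc_atMost)
  finally have "p dvd (\<Sum>j<i. coeff g j * coeff h (i - j)) + coeff g i * coeff h 0" .
  moreover have "p dvd (\<Sum>j<i. coeff g j * coeff h (i - j))"
    by (intro dvd_sum) (simp add: small)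
  ultimately have "p dvd coeff g i * coeff h 0" by (simp add: dvd_add_right_iff)
  with i h0 p show False by (simp add: prime_dvd_mult_iff)
qed

theorem eisenstein_criterion:
  fixes f :: "int poly"
  assumes p: "prime p" and deg: "degree f > 0"
    and dvd: "\<And>i. i < degree f \<Longrightarrow> p dvd coeff f i"
    and lead: "\<not> p dvd lead_coeff f" and const: "\<not> p\<^sup>2 dvd coeff f 0"
  shows "irreducible (map_poly rat_of_int f)"
proof (rule irreducibleI)
  have f0: "f \<noteq> 0" using deg by auto
  show "map_poly rat_of_int f \<noteq> 0"
    using deg by (metis degree_0 degree_map_poly of_int_eq_0_iff less_irrefl)
  show "\<not> is_unit (map_poly rat_of_int f)"
    using deg by (auto simp: is_unit_poly_iff degree_map_poly dest!: arg_cong[of _ _ degree])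
  fix g h assume gh: "map_poly rat_of_int f = g * h"
  hence "g \<noteq> 0" "h \<noteq> 0" using \<open>map_poly rat_of_int f \<noteq> 0\<close> by auto
  obtain G H where GH: "f = G * H" "degree G = degree g" "degree H = degree h"
    by (rule int_poly_factor_of_rat_factor[OF f0 gh])
  have c0: "coeff f 0 = coeff G 0 * coeff H 0" by (simp add: GH(1) coeff_mult)
  have "p dvd coeff G 0 * coeff H 0" using dvd[of 0] deg c0 by simp
  \<comment> \<open>Exactly one constant coefficient takes the factor \<open>p\<close>;
    \<open>eisenstein_no_split\<close> then makes the other polynomial constant.\<close>
  moreover have "\<not> (p dvd coeff G 0 \<and> p dvd coeff H 0)"
    using const by (auto simp: c0 power2_eq_square mult_dvd_mono)
  ultimately consider "p dvd coeff G 0" "\<not> p dvd coeff H 0" | "p dvd coeff H 0" "\<not> p dvd coeff G 0"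
    using p by (auto simp: prime_dvd_mult_iff)
  hence "degree G = 0 \<or> degree H = 0"
  proof cases
    case 1
    thus ?thesis
      using eisenstein_no_split[of p G H] p dvd lead by (simp add: GH(1))
  next
    case 2
    thus ?thesis
      using eisenstein_no_split[of p H G] p dvd lead by (simp add: GH(1) mult.commute[of H G])
  qed
  thus "is_unit g \<or> is_unit h"
    using \<open>g \<noteq> 0\<close> \<open>h \<noteq> 0\<close> by (simp add: GH is_unit_iff_degree)
qed

text \<open>Reversal is multiplicative, and it preserves the degree of a polynomial with nonzero
  constant coefficient. The factors of \<open>f\<close> inherit that property, so a unit among the
  reversed factors comes from a unit.\<close>

lemma irreducible_of_irreducible_reflect_poly:
  fixes f :: "'a :: field poly"
  assumes "coeff f 0 \<noteq> 0" and irr: "irreducible (reflect_poly f)"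
  shows "irreducible f"
proof (rule irreducibleI)
  show "f \<noteq> 0" using assms by auto
  show "\<not> is_unit f"
  proof
    assume "is_unit f"
    then obtain c where "f = [:c:]" "c \<noteq> 0"
      by (auto simp: is_unit_poly_iff dvd_field_iff)
    with irr show False by (simp add: irreducible_def is_unit_poly_iff dvd_field_iff)
  qed
  fix g h assume gh: "f = g * h"
  with assms(1) have nz: "coeff g 0 \<noteq> 0" "coeff h 0 \<noteq> 0" by (auto simp: coeff_mult)
  hence "g \<noteq> 0" "h \<noteq> 0" by auto
  moreover have "is_unit (reflect_poly g) \<or> is_unit (reflect_poly h)"
    using irr by (auto simp: gh reflect_poly_mult dest: irreducibleD)
  ultimately show "is_unit g \<or> is_unit h"
    using nz by (auto simp: is_unit_iff_degree)
qed

text \<open>Substituting a polynomial of degree 1 is multiplicative and preserves degrees, so it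
  neither creates nor destroys units among nonzero polynomials.\<close>

lemma irreducible_of_irreducible_pcompose:
  fixes f :: "'a :: field poly"
  assumes q: "degree q = 1" and irr: "irreducible (pcompose f q)"
  shows "irreducible f"
proof (rule irreducibleI)
  show nz: "f \<noteq> 0" using irr by auto
  have unit: "is_unit (pcompose g q) \<longleftrightarrow> is_unit g" if "g \<noteq> 0" for g
  proof -
    have "pcompose g q \<noteq> 0" using that q by (metis pcompose_eq_0 less_numeral_extra(1))
    thus ?thesis using that q by (simp add: is_unit_iff_degree degree_pcompose)
  qed
  show "\<not> is_unit f" using irr unit[OF nz] by (simp add: irreducible_def)
  fix g h assume gh: "f = g * h"
  with nz have "g \<noteq> 0" "h \<noteq> 0" by auto
  moreover have "is_unit (pcompose g q) \<or> is_unit (pcompose h q)"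
    using irr by (auto simp: gh pcompose_mult dest: irreducibleD)
  ultimately show "is_unit g \<or> is_unit h" by (simp add: unit)
qed

corollary eisenstein_criterion_reversed:
  fixes f :: "int poly"
  assumes p: "prime p" and deg: "degree f > 0"
    and dvd: "\<And>i. 0 < i \<Longrightarrow> i \<le> degree f \<Longrightarrow> p dvd coeff f i"
    and const: "\<not> p dvd coeff f 0" and lead: "\<not> p\<^sup>2 dvd lead_coeff f"
  shows "irreducible (map_poly rat_of_int f)"
proof (rule irreducible_of_irreducible_reflect_poly)
  have f0: "coeff f 0 \<noteq> 0" using const by auto
  thus "coeff (map_poly rat_of_int f) 0 \<noteq> 0" by (simp add: coeff_map_poly)
  have "irreducible (map_poly rat_of_int (reflect_poly f))"
    by (rule eisenstein_criterion[OF p])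
       (use deg dvd const lead f0 in \<open>auto simp: coeff_reflect_poly\<close>)
  also have "map_poly rat_of_int (reflect_poly f) = reflect_poly (map_poly rat_of_int f)"
    by (rule poly_eqI) (simp add: coeff_map_poly coeff_reflect_poly degree_map_poly)
  finally show "irreducible (reflect_poly (map_poly rat_of_int f))" .
qed

section \<open>Truncated negative binomial series\<close>

text \<open>Multiply the Bezout identity by (1 + x)^-(n+1) as formal power series. The term with
  \<open>P_poly n\<close> is a multiple of x^(n+1), hence invisible in the coefficients up to
  \<open>n\<close>.\<close>

lemma coeff_Q_poly:
  "coeff (Q_poly n) j = (if j \<le> n then (-1) ^ j * of_nat (n + j choose j) else 0)"
proof (cases "j \<le> n")
  case False
  thus ?thesis
    using bezout_pair_PQ[of n] by (auto simp: bezout_pair_def intro!: coeff_eq_0)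
next
  case True
  let ?X = "1 + fps_X :: rat fps"
  have "P_poly n * [:0, 1:] ^ (n + 1) + Q_poly n * [:1, 1:] ^ (n + 1) = 1"
    using bezout_pair_PQ[of n] by (simp add: bezout_pair_def)
  from arg_cong[OF this, of fps_of_poly]
  have eq: "fps_of_poly (P_poly n) * fps_X ^ (n + 1) + fps_of_poly (Q_poly n) * ?X ^ (n + 1) = 1"
    by (simp add: fps_of_poly_add fps_of_poly_mult fps_of_poly_power fps_of_poly_pCons
             del: power_Suc)
  have inv: "?X ^ (n + 1) * inverse (?X ^ (n + 1)) = 1"
    by (rule inverse_mult_eq_1') (simp add: fps_nth_power_0)
  let ?B = "fps_binomial (- of_nat (n + 1)) :: rat fps"
  have B: "?B = inverse (?X ^ (n + 1))" by (rule fps_binomial_minus_of_nat)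
  have "?B = (fps_of_poly (P_poly n) * fps_X ^ (n + 1) + fps_of_poly (Q_poly n) * ?X ^ (n + 1)) * ?B"
    unfolding eq by simp
  also have "\<dots> = fps_of_poly (P_poly n) * ?B * fps_X ^ (n + 1)
                  + fps_of_poly (Q_poly n) * (?X ^ (n + 1) * ?B)"
    by (simp only: algebra_simps)
  also have "?X ^ (n + 1) * ?B = 1" unfolding B by (rule inv)
  finally have "?B $ j = (fps_of_poly (P_poly n) * ?B * fps_X ^ (n + 1) + fps_of_poly (Q_poly n)) $ j"
    by (simp only: mult_1_right)
  also have "\<dots> = coeff (Q_poly n) j"
    using True by (simp add: fps_X_power_mult_right_nth del: power_Suc)
  finally have "coeff (Q_poly n) j = (- of_nat (n + 1) gchoose j)" by simp
  also have "\<dots> = (-1) ^ j * (of_nat (n + j) gchoose j)"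
    by (subst gbinomial_minus) (simp add: algebra_simps)
  also have "\<dots> = (-1) ^ j * of_nat (n + j choose j)"
    by (simp only: binomial_gbinomial)
  finally show ?thesis using True by simp
qed

text \<open>The series of (1 - x)^-(N+1) cut off after degree \<open>m\<close>, kept over the
  integers so that divisibility by primes makes sense.\<close>

definition truncated_neg_binomial :: "nat \<Rightarrow> nat \<Rightarrow> int poly" where
  "truncated_neg_binomial N m = (\<Sum>i\<le>m. monom (int (N + i choose i)) i)"

lemma coeff_truncated_neg_binomial:
  "coeff (truncated_neg_binomial N m) i = (if i \<le> m then int (N + i choose i) else 0)"
  by (auto simp: truncated_neg_binomial_def coeff_sum)

lemma degree_truncated_neg_binomial: "degree (truncated_neg_binomial N m) = m"
  by (rule antisym[OF degree_le le_degree]) (auto simp: coeff_truncated_neg_binomial)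

lemma pcompose_higher_pderiv_Q_poly:
  assumes "k \<le> n"
  shows "pcompose ((pderiv ^^ k) (Q_poly n)) [:0, -1:]
           = smult ((-1) ^ k * fact (n + k) / fact n)
               (map_poly rat_of_int (truncated_neg_binomial (n + k) (n - k)))"
proof (rule poly_eqI)
  fix i
  show "coeff (pcompose ((pderiv ^^ k) (Q_poly n)) [:0, -1:]) i
          = coeff (smult ((-1) ^ k * fact (n + k) / fact n)
              (map_poly rat_of_int (truncated_neg_binomial (n + k) (n - k)))) i"
  proof (cases "i \<le> n - k")
    case False
    thus ?thesis
      using assms by (simp add: coeff_pcompose_linear coeff_higher_pderiv coeff_Q_poly
                               coeff_map_poly coeff_truncated_neg_binomial)
  next
    case True
    have 1: "(of_nat (n + (i + k) choose (i + k)) :: rat) = fact (n + i + k) / (fact (i + k) * fact n)"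
      by (subst binomial_fact) (simp_all add: add.assoc)
    have 2: "(of_nat (n + k + i choose i) :: rat) = fact (n + i + k) / (fact i * fact (n + k))"
      by (subst binomial_fact) (simp_all add: add_ac)
    \<comment> \<open>The product (i+1)...(i+k) that \<open>k\<close> derivatives bring down from
      x^(i+k).\<close>
    have 3: "pochhammer (of_nat (Suc i) :: rat) k = fact (i + k) / fact i"
      using pochhammer_product'[of "1 :: rat" i k]
      unfolding pochhammer_fact[symmetric] by (simp add: field_simps)
    \<comment> \<open>The sign from substituting -x cancels the alternating sign of
      \<open>Q_poly n\<close> up to a factor independent of \<open>i\<close>.\<close>
    have sign: "(-1) ^ i * (-1) ^ (i + k) = ((-1) ^ k :: rat)"
      by (simp add: power_add flip: mult.assoc power_mult_distrib)
    have "coeff (pcompose ((pderiv ^^ k) (Q_poly n)) [:0, -1:]) i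
            = (-1) ^ i * (-1) ^ (i + k) * (pochhammer (of_nat (Suc i)) k
                * of_nat (n + (i + k) choose (i + k)))"
      using True assms by (simp add: coeff_pcompose_linear coeff_higher_pderiv coeff_Q_poly)
    also have "\<dots> = (-1) ^ k * fact (n + k) / fact n * of_nat (n + k + i choose i)"
      unfolding sign 1 2 3 by simp
    also have "\<dots> = coeff (smult ((-1) ^ k * fact (n + k) / fact n)
                    (map_poly rat_of_int (truncated_neg_binomial (n + k) (n - k)))) i"
      using True by (simp add: coeff_map_poly coeff_truncated_neg_binomial)
    finally show ?thesis .
  qed
qed

text \<open>The hockey-stick identity; the terms with \<open>i < j\<close> vanish, so the sum may
  start at 0.\<close>

lemma sum_choose_shifted:
  "(\<Sum>i\<le>m. N + i choose (N + j)) = N + m + 1 choose (N + j + 1)"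
  by (induction m) (cases j; simp)+

lemma pcompose_power: "pcompose (p ^ n) q = pcompose p q ^ n"
  by (induction n) (simp_all add: pcompose_mult pcompose_1)

lemma coeff_one_plus_X_power: "coeff ([:1, 1:] ^ n :: int poly) i = int (n choose i)"
proof (cases "i \<le> n")
  case True
  thus ?thesis by (simp add: coeff_linear_poly_power)
next
  case False
  thus ?thesis by (simp add: binomial_eq_0 coeff_eq_0 degree_linear_power)
qed

text \<open>For \<open>j \<le> i\<close> both sides equal (N+i)! / (N! j! (i-j)!). The right-hand
  side confines \<open>i\<close> to one factor, ready for summation over \<open>i\<close>.\<close>

lemma choose_mult_shifted:
  "(N + i choose i) * (i choose j) = (N + j choose j) * (N + i choose (N + j))"
proof (cases "j \<le> i")
  case True
  have "(N + i choose i) * (i choose j) = (N + i choose j) * (N + i - j choose (i - j))"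
    using True by (intro choose_mult) auto
  also have "N + i - j choose (i - j) = N + i - j choose N"
    using True by (subst binomial_symmetric) auto
  also have "(N + i choose j) * (N + i - j choose N) = (N + i choose (N + j)) * (N + j choose j)"
    using True by (subst choose_mult) auto
  finally show ?thesis by simp
qed (simp add: binomial_eq_0)

lemma coeff_pcompose_truncated_neg_binomial:
  "coeff (pcompose (truncated_neg_binomial N m) [:1, 1:]) j
     = int ((N + j choose j) * (N + m + 1 choose (N + j + 1)))"
proof -
  have "pcompose (truncated_neg_binomial N m) [:1, 1:]
          = (\<Sum>i\<le>m. smult (int (N + i choose i)) ([:1, 1:] ^ i))"
    by (simp add: truncated_neg_binomial_def pcompose_sum monom_altdef pcompose_smult
        pcompose_power pcompose_pCons)
  hence "coeff (pcompose (truncated_neg_binomial N m) [:1, 1:]) j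
          = int (\<Sum>i\<le>m. (N + i choose i) * (i choose j))"
    by (simp add: coeff_sum coeff_one_plus_X_power)
  also have "(\<Sum>i\<le>m. (N + i choose i) * (i choose j))
               = (N + j choose j) * (N + m + 1 choose (N + j + 1))"
    by (subst choose_mult_shifted) (simp only: sum_distrib_left[symmetric] sum_choose_shifted)
  finally show ?thesis .
qed

section \<open>Divisibility of binomial coefficients by a prime\<close>

lemma prime_not_dvd_choose_less:
  fixes p :: nat
  assumes "prime p" "n < p" "k \<le> n"
  shows "\<not> p dvd n choose k"
proof
  assume "p dvd n choose k"
  hence "p dvd fact k * fact (n - k) * (n choose k)" by simp
  hence "p dvd fact n" using binomial_fact_lemma[OF assms(3)] by simp
  with assms show False by (simp add: prime_dvd_fact_iff)
qed

text \<open>Induction via (t+1) C(p+t+1, p) = (p+t+1) C(p+t, p): the factor p+t+1 is prime to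
  \<open>p\<close> as long as t+1 < p.\<close>

lemma prime_not_dvd_choose_self_add:
  fixes p :: nat
  assumes "prime p" "t < p"
  shows "\<not> p dvd p + t choose p"
  using assms(2)
proof (induction t)
  case 0
  thus ?case using assms(1) prime_gt_1_nat[of p] by simp
next
  case (Suc t)
  show ?case
  proof
    assume "p dvd p + Suc t choose p"
    hence "p dvd (p + Suc t - p) * (p + Suc t choose p)" by simp
    hence "p dvd (p + Suc t) * (p + t choose p)"
      unfolding binomial_absorb_comp by simp
    hence "p dvd p + Suc t \<or> p dvd p + t choose p"
      using assms(1) by (simp only: prime_dvd_mult_iff)
    moreover have "\<not> p dvd Suc t" using Suc.prems by (auto dest: dvd_imp_le)
    hence "\<not> p dvd p + Suc t" using dvd_add_right_iff[of p p "Suc t"] by simp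
    ultimately show False using Suc by simp
  qed
qed

lemma prime_dvd_choose_self:
  fixes p :: nat
  assumes "prime p" "0 < r" "r < p"
  shows "p dvd p choose r"
proof -
  have "r * (p choose r) = p * (p - 1 choose (r - 1))"
    using binomial_absorption[of "r - 1" p] assms by simp
  hence "p dvd r * (p choose r)" by simp
  moreover have "\<not> p dvd r" using assms by (auto dest: dvd_imp_le)
  ultimately show ?thesis using assms(1) by (simp add: prime_dvd_mult_iff)
qed

text \<open>In r C(p, r) = p C(p-1, r-1) the last binomial coefficient is prime to \<open>p\<close>,
  so a second factor \<open>p\<close> is impossible.\<close>

lemma prime_square_not_dvd_choose:
  fixes p :: nat
  assumes "prime p" "0 < r" "r \<le> p"
  shows "\<not> p\<^sup>2 dvd p choose r"
proof
  assume "p\<^sup>2 dvd p choose r"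
  hence "p\<^sup>2 dvd r * (p choose r)" by simp
  also have "r * (p choose r) = p * (p - 1 choose (r - 1))"
    using binomial_absorption[of "r - 1" p] assms by simp
  finally have "p dvd p - 1 choose (r - 1)"
    using assms by (simp add: power2_eq_square prime_gt_0_nat)
  with prime_not_dvd_choose_less[of p "p - 1" "r - 1"] assms show False
    by (simp add: prime_gt_0_nat)
qed

text \<open>Makes the factor N+1 of C(N+i, i) explicit, for use when N+1 is prime and
  \<open>i\<close> is invertible modulo it.\<close>

lemma choose_Suc_absorb:
  "i * (N + i choose i) = Suc N * (N + i choose Suc N)"
proof (cases i)
  case (Suc j)
  have "N + i choose i = N + i choose N" by (subst binomial_symmetric) auto
  hence "i * (N + i choose i) = (N + i) * (N + i - 1 choose N)"
    using binomial_absorb_comp[of "N + i" N] by simp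
  also have "\<dots> = Suc N * (N + i choose Suc N)" by (rule binomial_absorption[symmetric])
  finally show ?thesis .
qed simp

lemma prime_dvd_choose_pred_add:
  assumes "prime (Suc N)" "0 < i" "i \<le> N"
  shows "Suc N dvd N + i choose i" and "\<not> (Suc N)\<^sup>2 dvd N + i choose i"
proof -
  have "Suc N dvd i * (N + i choose i)" unfolding choose_Suc_absorb by (rule dvd_triv_left)
  moreover have "\<not> Suc N dvd i" using assms by (auto dest: dvd_imp_le)
  ultimately show "Suc N dvd N + i choose i"
    using assms(1) by (simp only: prime_dvd_mult_iff simp_thms)
  show "\<not> (Suc N)\<^sup>2 dvd N + i choose i"
  proof
    assume "(Suc N)\<^sup>2 dvd N + i choose i"
    hence "(Suc N)\<^sup>2 dvd i * (N + i choose i)" by simp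
    hence "Suc N dvd N + i choose Suc N"
      unfolding choose_Suc_absorb power2_eq_square by (simp only: nat_mult_dvd_cancel_disj) simp
    \<comment> \<open>With p = N+1 the cofactor is C(p + (i-1), p), which is prime to
      \<open>p\<close> because i-1 < p.\<close>
    also have "N + i = Suc N + (i - 1)" using assms by simp
    finally have "Suc N dvd Suc N + (i - 1) choose Suc N" .
    moreover have "i - 1 < Suc N" using assms(3) by linarith
    ultimately show False
      using prime_not_dvd_choose_self_add[OF assms(1)] by blast
  qed
qed

section \<open>Irreducibility\<close>

lemma irreducible_truncated_neg_binomial_prime_Suc:
  assumes "prime (Suc N)" "0 < m" "m \<le> N"
  shows "irreducible (map_poly rat_of_int (truncated_neg_binomial N m))"
proof (rule eisenstein_criterion_reversed)
  show "prime (int (Suc N))" using assms by (simp only: prime_nat_int_transfer)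
  show "0 < degree (truncated_neg_binomial N m)"
    using assms by (simp add: degree_truncated_neg_binomial)
  show "int (Suc N) dvd coeff (truncated_neg_binomial N m) i"
    if "0 < i" "i \<le> degree (truncated_neg_binomial N m)" for i
    using that assms prime_dvd_choose_pred_add(1)[of N i]
    by (simp add: degree_truncated_neg_binomial coeff_truncated_neg_binomial del: of_nat_Suc)
  show "\<not> int (Suc N) dvd coeff (truncated_neg_binomial N m) 0"
    using assms by (auto simp: coeff_truncated_neg_binomial)
  show "\<not> (int (Suc N))\<^sup>2 dvd lead_coeff (truncated_neg_binomial N m)"
    using assms prime_dvd_choose_pred_add(2)[of N m]
    by (simp add: degree_truncated_neg_binomial coeff_truncated_neg_binomial
        del: of_nat_Suc of_nat_power flip: of_nat_power)
qed

lemma irreducible_truncated_neg_binomial_prime_add: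
  assumes "prime (N + m + 1)" "0 < m"
  shows "irreducible (map_poly rat_of_int (truncated_neg_binomial N m))"
proof (rule irreducible_of_irreducible_pcompose)
  let ?p = "N + m + 1"
  let ?f = "pcompose (truncated_neg_binomial N m) [:1, 1:]"
  note coeff_f = coeff_pcompose_truncated_neg_binomial[of N m]
  have deg: "degree ?f = m"
    by (simp add: degree_pcompose degree_truncated_neg_binomial)
  show "degree [:1, 1 :: rat:] = 1" by simp
  have "irreducible (map_poly rat_of_int ?f)"
  proof (rule eisenstein_criterion)
    show "prime (int ?p)" using assms by (simp only: prime_nat_int_transfer)
    show "0 < degree ?f" using assms by (simp add: deg)
    show "int ?p dvd coeff ?f i" if "i < degree ?f" for i
    proof -
      \<comment> \<open>Below the leading index, N+i+1 lies strictly between 0 and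
        \<open>?p\<close>.\<close>
      have "?p dvd ?p choose (N + i + 1)"
        using that assms by (intro prime_dvd_choose_self) (auto simp: deg)
      thus ?thesis unfolding coeff_f int_dvd_int_iff by (rule dvd_mult)
    qed
    \<comment> \<open>At index \<open>m\<close> the second binomial is C(p, p) = 1, leaving C(N+m,
      m), whose upper entry is below \<open>?p\<close>.\<close>
    show "\<not> int ?p dvd lead_coeff ?f"
      using prime_not_dvd_choose_less[OF assms(1), of "N + m" m]
      unfolding deg coeff_f int_dvd_int_iff by simp
    \<comment> \<open>At index 0 the first binomial is 1, leaving C(p, N+1).\<close>
    show "\<not> (int ?p)\<^sup>2 dvd coeff ?f 0"
      using prime_square_not_dvd_choose[OF assms(1), of "N + 1"]
      unfolding coeff_f int_dvd_int_iff of_nat_power[symmetric] by simp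
  qed
  also have "map_poly rat_of_int ?f
               = pcompose (map_poly rat_of_int (truncated_neg_binomial N m)) [:1, 1:]"
    by (simp add: map_poly_of_int_pcompose map_poly_pCons)
  finally show "irreducible (pcompose (map_poly rat_of_int (truncated_neg_binomial N m)) [:1, 1:])" .
qed

theorem theorem8p1:
  fixes n k :: nat
  assumes "n \<ge> 1" and "k \<le> n - 1"
    and "prime (n + k + 1) \<or> prime (2 * n + 1)"
  shows "irreducible ((pderiv ^^ k) (Q_poly n))"
proof -
  let ?F = "map_poly rat_of_int (truncated_neg_binomial (n + k) (n - k))"
  have "irreducible ?F"
    using assms(3)
  proof
    assume "prime (n + k + 1)"
    thus ?thesis
      using assms by (intro irreducible_truncated_neg_binomial_prime_Suc) auto
  next
    assume "prime (2 * n + 1)"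
    \<comment> \<open>The sum of n+k and n-k does not depend on \<open>k\<close>, which is why this
      prime condition does not involve \<open>k\<close>.\<close>
    moreover have "2 * n + 1 = n + k + (n - k) + 1" using assms by simp
    ultimately have "prime (n + k + (n - k) + 1)" by (simp only:)
    thus ?thesis
      using assms by (intro irreducible_truncated_neg_binomial_prime_add) auto
  qed
  \<comment> \<open>The scalar is written as a constant polynomial, a unit over the rationals, so
    that it can be absorbed.\<close>
  hence "irreducible ([:(-1) ^ k * fact (n + k) / fact n:] * ?F)"
    by (subst irreducible_mult_unit_left) (auto simp: is_unit_poly_iff dvd_field_iff)
  hence "irreducible (pcompose ((pderiv ^^ k) (Q_poly n)) [:0, -1:])"
    using assms by (simp add: pcompose_higher_pderiv_Q_poly)
  thus ?thesis by (rule irreducible_of_irreducible_pcompose[rotated]) simp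
qed

end
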